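(* Let $d\geq 1$ and $\alpha\geq 2$ be integers, set $n=2d+1$, and for $(z,t)\in\mathbb{R}^{2d}\times\mathbb{R}$ let $\|(z,t)\|_\alpha=\big(|z|^\alpha+|t|^{\alpha/2}\big)^{1/\alpha}$. Then for all $R>1$ and $0\leq\delta<1$, $$\#\big(\{(m,p)\in\mathbb{Z}^{n}\times\mathbb{Z}^{n}: \big|\|m\|_\alpha-R\big|\leq\delta \text{ and } \big|\|m-p\|_\alpha-R\big|\leq\delta\}\big)\lesssim\max\Big\{R^{2\left(n-\frac{\gamma(\alpha)}{n-1-\gamma(\alpha)}\right)},\,(R^n\delta)^2\Big\},$$ where $\gamma(\alpha)=\min\left\{\frac{n-1}{\alpha},\frac12\right\}$ when $\alpha\geq 3$, and $\gamma(\alpha)=\frac{n-2}{2}$ when $\alpha=2$.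
   Context: $|z|$ is the Euclidean norm of $z\in\mathbb{R}^{2d}$. $\mathbb{Z}^n=\mathbb{Z}^{2d}\times\mathbb{Z}$ is viewed inside $\mathbb{R}^{2d}\times\mathbb{R}$, and $m-p$ is the usual (Euclidean) vector difference. $\#(\cdot)$ denotes the cardinality of a finite set. $x\lesssim y$ means $x\leq Cy$ for some constant $C>0$; here $C$ may depend on $d$ and $\alpha$ but not on $R$ or $\delta$. *)

theory Defs
  imports "HOL-Analysis.Analysis"
begin

definition hom_norm :: "nat \<Rightarrow> (real ^ 'm) \<times> real \<Rightarrow> real" where
  "hom_norm \<alpha> = (\<lambda>(z, t).
     (norm z ^ \<alpha> + \<bar>t\<bar> powr (real \<alpha> / 2)) powr (1 / real \<alpha>))"

definition int_lattice :: "((real ^ 'm) \<times> real) set" where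
  "int_lattice = {(z, t). (\<forall>i. z $ i \<in> \<int>) \<and> t \<in> \<int>}"

(* Only used for \<alpha> \<ge> 2, so the else branch is the case \<alpha> \<ge> 3. *)
definition gamma_exp :: "nat \<Rightarrow> nat \<Rightarrow> real" where
  "gamma_exp n \<alpha> =
     (if \<alpha> = 2 then (real n - 2) / 2
      else min ((real n - 1) / real \<alpha>) (1 / 2))"

end

theory Submission
  imports Defs
begin

text \<open>
  The map \<open>(m, p) \<mapsto> (m, m - p)\<close> turns the pairs to be counted into all pairs from the set
  \<open>A\<close> of lattice points \<open>m\<close> with \<open>\<bar>\<parallel>m\<parallel> - R\<bar> \<le> \<delta>\<close>. So the number of pairs is the square of the
  cardinality of \<open>A\<close>, and only a bound for a single annulus is needed. With \<open>N = 2 d\<close> the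
  number of horizontal coordinates, \<open>n = N + 1\<close> and \<open>\<beta> = 2 / \<alpha>\<close>, the bound
  \[ \# A \lesssim R^N + R^{N + 1 - \beta} + R^{N + 1} \delta \]
  (\<open>card_lattice_near_sphere\<close>) suffices, because \<open>e = \<gamma> / (n - 1 - \<gamma>)\<close> is at most both \<open>1\<close>
  and \<open>\<beta>\<close> (\<open>gamma_exp_quotient_le\<close>), so that the first two terms are at most \<open>R powr (n - e)\<close>.
  No exponential sums enter.

  The bound comes from slicing \<open>A\<close> by the Euclidean norm of the horizontal part \<open>z\<close>. Each slice,
  a shell of thickness one, contains \<open>O(R ^ (N - 1))\<close> integer vectors
  (\<open>card_int_vectors_in_shell\<close>). Over a fixed \<open>z\<close> at depth \<open>R + 1 - \<bar>z\<bar> \<approx> j\<close>, the admissible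
  heights satisfy \<open>(R - \<delta>) ^ \<alpha> - \<bar>z\<bar> ^ \<alpha> \<le> \<bar>t\<bar> powr (\<alpha> / 2) \<le> (R + \<delta>) ^ \<alpha> - \<bar>z\<bar> ^ \<alpha>\<close>. For
  large \<open>j\<close> both ends are at least of order \<open>j R ^ (\<alpha> - 1)\<close>, and they differ by
  \<open>O(\<delta> R ^ (\<alpha> - 1))\<close>; taking the power \<open>\<beta> \<le> 1\<close> leaves an interval of length
  \<open>O(\<delta> j powr (\<beta> - 1) R powr (2 - \<beta>))\<close> for \<open>\<bar>t\<bar>\<close>. In the few shells next to the equator
  \<open>\<bar>z\<bar> = R\<close> the lower end may vanish, and there the whole range \<open>\<bar>t\<bar> = O(R powr (2 - \<beta>))\<close> is
  used (\<open>height_gap\<close>). An interval of length \<open>D\<close> contains at most \<open>D + 1\<close> integers. Summing over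
  the \<open>O(R)\<close> shells, the summand \<open>1\<close> gives \<open>R ^ N\<close>, the equator gives \<open>R powr (N + 1 - \<beta>)\<close>,
  and the other intervals give \<open>R ^ (N + 1) \<delta>\<close>, since the sum of \<open>j powr (\<beta> - 1)\<close> over
  \<open>j = O(R)\<close> is \<open>O(R powr \<beta>)\<close> (\<open>sum_powr_le\<close>).
\<close>

section \<open>Integer points in a Euclidean unit shell\<close>

lemma card_le_card_fibres:
  fixes K :: real
  assumes "finite B" and "f ` A \<subseteq> B"
    and fib: "\<And>b. b \<in> B \<Longrightarrow> finite {a \<in> A. f a = b} \<and> real (card {a \<in> A. f a = b}) \<le> K"
  shows "finite A \<and> real (card A) \<le> K * real (card B)"
proof -
  have A: "A = (\<Union>b\<in>B. {a \<in> A. f a = b})" using assms(2) by auto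
  have "finite A" by (subst A, rule finite_UN_I) (use assms in auto)
  have "card A \<le> (\<Sum>b\<in>B. card {a \<in> A. f a = b})"
    by (subst A, rule card_UN_le[OF assms(1)])
  then have "real (card A) \<le> (\<Sum>b\<in>B. real (card {a \<in> A. f a = b}))"
    by (metis of_nat_le_iff of_nat_sum)
  also have "\<dots> \<le> (\<Sum>b\<in>B. K)" by (intro sum_mono) (use fib in auto)
  finally show ?thesis using \<open>finite A\<close> by (simp add: mult.commute)
qed

text \<open>
  The points may have either sign, so they lie in two intervals of length \<open>2 D\<close>, centred at
  \<open>\<bar>y\<bar>\<close> and \<open>- \<bar>y\<bar>\<close> for any one of them. Bounding differences of absolute values fits sets that
  are given by a constraint on \<open>\<bar>x\<bar>\<close>.
\<close>
lemma card_Ints_close_abs: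
  fixes A :: "real set"
  assumes "A \<subseteq> \<int>" and "D \<ge> 0"
    and close: "\<And>x y. x \<in> A \<Longrightarrow> y \<in> A \<Longrightarrow> \<bar>x\<bar> - \<bar>y\<bar> \<le> D"
  shows "finite A \<and> real (card A) \<le> 4 * D + 2"
proof (cases "A = {}")
  case True
  then show ?thesis using \<open>D \<ge> 0\<close> by simp
next
  case False
  then obtain y where y: "y \<in> A" by blast
  then obtain c where c: "y = of_int c" using assms(1) by (meson Ints_cases subsetD)
  define e where "e = \<lfloor>D\<rfloor>"
  have e: "e \<ge> 0" "of_int e \<le> D" using \<open>D \<ge> 0\<close> by (auto simp: e_def)
  let ?I = "{\<bar>c\<bar> - e..\<bar>c\<bar> + e} \<union> {- \<bar>c\<bar> - e..- \<bar>c\<bar> + e}"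
  have sub: "A \<subseteq> of_int ` ?I"
  proof
    fix x assume x: "x \<in> A"
    then obtain k where k: "x = of_int k" using assms(1) by (meson Ints_cases subsetD)
    have "of_int (\<bar>k\<bar> - \<bar>c\<bar>) \<le> D" "of_int (\<bar>c\<bar> - \<bar>k\<bar>) \<le> D"
      using close[OF x y] close[OF y x] by (auto simp: k c)
    then have "\<bar>k\<bar> - \<bar>c\<bar> \<le> e" "\<bar>c\<bar> - \<bar>k\<bar> \<le> e" unfolding e_def by (auto simp: le_floor_iff)
    then have "k \<in> ?I" by auto
    then show "x \<in> of_int ` ?I" using k by blast
  qed
  have "card A \<le> card (of_int ` ?I :: real set)" by (rule card_mono[OF _ sub]) simp
  also have "\<dots> \<le> card ?I" by (rule card_image_le) simp
  also have "\<dots> \<le> nat (2 * e + 1) + nat (2 * e + 1)"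
    by (rule order_trans[OF card_Un_le]) simp
  finally have "real (card A) \<le> 2 * (2 * of_int e + 1)" using e(1) by (simp flip: of_nat_le_iff [where 'a = real])
  then show ?thesis using e finite_subset[OF sub] by auto
qed

text \<open>
  The power of \<open>a + 1\<close> is one below the dimension because a coordinate of largest modulus is
  determined by the others up to a bounded number of choices: its square is known up to
  \<open>(a + 1)\<^sup>2 - a\<^sup>2 = 2 a + 1\<close>, while its modulus is at least \<open>a / CARD('m)\<close>, so the modulus
  itself is known up to a constant.
\<close>
lemma card_int_vectors_in_shell:
  fixes a :: real
  assumes a: "a \<ge> 0"
  defines "Sh \<equiv> {z :: real ^ 'm. (\<forall>i. z $ i \<in> \<int>) \<and> a \<le> norm z \<and> norm z \<le> a + 1}"
  shows "finite Sh \<and> real (card Sh) \<le>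
    real CARD('m) * (8 * real CARD('m) + 2) * (3 * (a + 1)) ^ (CARD('m) - 1)"
proof -
  let ?N = "real CARD('m)"
  have N1: "?N \<ge> 1" by (simp add: Suc_leI)
  define W where "W i = {z \<in> Sh. \<forall>j. \<bar>z $ j\<bar> \<le> \<bar>z $ i\<bar>}" for i
  define G :: "real set" where "G = of_int ` {- \<lfloor>a + 1\<rfloor>..\<lfloor>a + 1\<rfloor>}"
  have G: "finite G" "real (card G) \<le> 3 * (a + 1)"
  proof -
    have "card G = nat (2 * \<lfloor>a + 1\<rfloor> + 1)"
      unfolding G_def by (subst card_image) (auto simp: inj_on_def)
    also have "real \<dots> = 2 * of_int \<lfloor>a + 1\<rfloor> + 1" using a by simp
    finally show "real (card G) \<le> 3 * (a + 1)" using a of_int_floor_le[of "a + 1"] by argo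
  qed (simp add: G_def)
  have coord: "z $ j \<in> G" if "z \<in> Sh" for z j
  proof -
    have "z $ j \<in> \<int>" using that unfolding Sh_def by auto
    then obtain k where k: "z $ j = of_int k" by (rule Ints_cases)
    have "\<bar>z $ j\<bar> \<le> a + 1"
      using component_le_norm_cart[of z j] that unfolding Sh_def by auto
    then have "k \<in> {- \<lfloor>a + 1\<rfloor>..\<lfloor>a + 1\<rfloor>}" unfolding k by (auto; linarith)
    then show ?thesis unfolding G_def k by blast
  qed
  have close: "\<bar>z $ i\<bar> - \<bar>w $ i\<bar> \<le> 2 * ?N"
    if z: "z \<in> W i" and w: "w \<in> W i" and eq: "\<And>j. j \<noteq> i \<Longrightarrow> z $ j = w $ j" for z w i
  proof -
    have sq: "(norm v)\<^sup>2 = (v $ i)\<^sup>2 + (\<Sum>j\<in>UNIV - {i}. (v $ j)\<^sup>2)" for v :: "real ^ 'm"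
      unfolding power2_norm_eq_inner inner_vec_def
      by (subst sum.remove[of _ i]) (auto simp: power2_eq_square)
    have "(\<Sum>j\<in>UNIV - {i}. (z $ j)\<^sup>2) = (\<Sum>j\<in>UNIV - {i}. (w $ j)\<^sup>2)"
      by (intro sum.cong) (auto simp: eq)
    then have "(z $ i)\<^sup>2 - (w $ i)\<^sup>2 = (norm z)\<^sup>2 - (norm w)\<^sup>2" by (simp add: sq)
    also have "\<dots> \<le> (a + 1)\<^sup>2 - a\<^sup>2"
      using z w a unfolding W_def Sh_def by (intro diff_mono power_mono) auto
    finally have d: "(\<bar>z $ i\<bar> - \<bar>w $ i\<bar>) * (\<bar>z $ i\<bar> + \<bar>w $ i\<bar>) \<le> 2 * a + 1"
      by (simp add: power2_eq_square algebra_simps)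
    have big: "a \<le> ?N * \<bar>v $ i\<bar>" if "v \<in> W i" for v
    proof -
      have "a \<le> norm v" using that unfolding W_def Sh_def by auto
      also have "\<dots> \<le> (\<Sum>j\<in>UNIV. \<bar>v $ j\<bar>)" by (rule norm_le_l1_cart)
      also have "\<dots> \<le> (\<Sum>j\<in>(UNIV::'m set). \<bar>v $ i\<bar>)"
        by (intro sum_mono) (use that in \<open>auto simp: W_def\<close>)
      finally show ?thesis by simp
    qed
    (* For a < 1 there is no useful lower bound on the modulus, but then it is less than 2. *)
    show ?thesis
    proof (cases "a \<ge> 1")
      case True
      show ?thesis
      proof (rule ccontr)
        assume "\<not> ?thesis"
        then have h: "2 * ?N \<le> \<bar>z $ i\<bar> - \<bar>w $ i\<bar>" by simp
        have "2 * (2 * a) \<le> 2 * (?N * (\<bar>z $ i\<bar> + \<bar>w $ i\<bar>))"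
          using big[OF z] big[OF w] by (simp add: algebra_simps)
        also have "\<dots> \<le> (\<bar>z $ i\<bar> - \<bar>w $ i\<bar>) * (\<bar>z $ i\<bar> + \<bar>w $ i\<bar>)"
          using mult_right_mono[OF h, of "\<bar>z $ i\<bar> + \<bar>w $ i\<bar>"] by (simp add: mult.assoc)
        finally show False using d True by linarith
      qed
    next
      case False
      have "\<bar>z $ i\<bar> \<le> a + 1"
        using component_le_norm_cart[of z i] z unfolding W_def Sh_def by auto
      then show ?thesis using False N1 by linarith
    qed
  qed
  have W: "finite (W i) \<and>
      real (card (W i)) \<le> (8 * ?N + 2) * (3 * (a + 1)) ^ (CARD('m) - 1)" for i
  proof -
    define f where "f z = restrict (\<lambda>j. z $ j) (UNIV - {i})" for z :: "real ^ 'm"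
    let ?B = "PiE (UNIV - {i}) (\<lambda>_. G)"
    have "finite {z \<in> W i. f z = b} \<and> real (card {z \<in> W i. f z = b}) \<le> 8 * ?N + 2" for b
    proof -
      let ?F = "{z \<in> W i. f z = b}"
      have eq: "z $ j = w $ j" if "z \<in> ?F" "w \<in> ?F" "j \<noteq> i" for z w j
        using that by (auto simp: f_def restrict_def fun_eq_iff) metis
      have inj: "inj_on (\<lambda>z. z $ i) ?F"
      proof (rule inj_onI)
        fix z w assume "z \<in> ?F" "w \<in> ?F" "z $ i = w $ i"
        then show "z = w" using eq[of z w] unfolding vec_eq_iff by metis
      qed
      have "finite ((\<lambda>z. z $ i) ` ?F) \<and> real (card ((\<lambda>z. z $ i) ` ?F)) \<le> 4 * (2 * ?N) + 2"
      proof (rule card_Ints_close_abs)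
        show "(\<lambda>z. z $ i) ` ?F \<subseteq> \<int>" unfolding W_def Sh_def by auto
        fix x y assume "x \<in> (\<lambda>z. z $ i) ` ?F" "y \<in> (\<lambda>z. z $ i) ` ?F"
        then obtain z w where "z \<in> ?F" "w \<in> ?F" "x = z $ i" "y = w $ i" by blast
        then show "\<bar>x\<bar> - \<bar>y\<bar> \<le> 2 * ?N" using close[of z i w] eq[of z w] by auto
      qed simp
      then show ?thesis using inj by (simp add: card_image finite_image_iff)
    qed
    moreover have "finite ?B" using G(1) by (intro finite_PiE) auto
    moreover have "f ` W i \<subseteq> ?B"
    proof (rule image_subsetI)
      fix z assume "z \<in> W i"
      then have "z \<in> Sh" by (simp add: W_def)
      then show "f z \<in> ?B" unfolding f_def restrict_PiE_iff using coord by blast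
    qed
    ultimately have "finite (W i) \<and> real (card (W i)) \<le> (8 * ?N + 2) * real (card ?B)"
      by (intro card_le_card_fibres) auto
    moreover have "real (card ?B) \<le> (3 * (a + 1)) ^ (CARD('m) - 1)"
      using power_mono[OF G(2)] by (simp add: card_PiE)
    ultimately show ?thesis
      by (auto intro: order_trans mult_left_mono)
  qed
  have cover: "Sh = (\<Union>i. W i)"
  proof -
    have "\<exists>i. \<forall>j. \<bar>z $ j\<bar> \<le> \<bar>z $ i\<bar>" for z :: "real ^ 'm"
    proof -
      have "Max (range (\<lambda>j. \<bar>z $ j\<bar>)) \<in> range (\<lambda>j. \<bar>z $ j\<bar>)" by (rule Max_in) auto
      then obtain i where i: "Max (range (\<lambda>j. \<bar>z $ j\<bar>)) = \<bar>z $ i\<bar>" by blast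
      have "\<bar>z $ j\<bar> \<le> \<bar>z $ i\<bar>" for j unfolding i[symmetric] by (rule Max_ge) auto
      then show ?thesis by blast
    qed
    then show ?thesis unfolding W_def by blast
  qed
  have "finite Sh" unfolding cover using W by (intro finite_UN_I) auto
  moreover have "real (card Sh) \<le> (\<Sum>i\<in>(UNIV::'m set). real (card (W i)))"
    unfolding cover using card_UN_le[of "UNIV :: 'm set" W]
    by (metis finite_class.finite_UNIV of_nat_le_iff of_nat_sum)
  moreover have "\<dots> \<le> (\<Sum>i\<in>(UNIV::'m set). (8 * ?N + 2) * (3 * (a + 1)) ^ (CARD('m) - 1))"
    by (intro sum_mono) (use W in blast)
  ultimately show ?thesis by (simp add: mult.assoc)
qed

section \<open>Elementary inequalities for powers\<close>

lemma power_diff_bounds: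
  fixes x y :: real
  assumes "0 \<le> y" and "y \<le> x" and "n \<ge> 1"
  shows "x ^ (n - 1) * (x - y) \<le> x ^ n - y ^ n"
    and "x ^ n - y ^ n \<le> real n * x ^ (n - 1) * (x - y)"
proof -
  obtain m where n: "n = Suc m" using assms(3) by (metis Suc_le_D One_nat_def)
  have "y ^ m * y \<le> x ^ m * y" using assms by (intro mult_right_mono power_mono) auto
  then show "x ^ (n - 1) * (x - y) \<le> x ^ n - y ^ n" by (simp add: n algebra_simps)
  have "x ^ Suc m - y ^ Suc m \<le> real (Suc m) * x ^ m * (x - y)"
  proof (induction m)
    case (Suc m)
    have "y ^ Suc m * (x - y) \<le> x ^ Suc m * (x - y)"
      using assms by (intro mult_right_mono power_mono) auto
    moreover have "x * (x ^ Suc m - y ^ Suc m) \<le> x * (real (Suc m) * x ^ m * (x - y))"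
      using assms by (intro mult_left_mono Suc.IH) auto
    ultimately show ?case by (simp add: algebra_simps)
  qed simp
  then show "x ^ n - y ^ n \<le> real n * x ^ (n - 1) * (x - y)" by (simp add: n)
qed

text \<open>
  The factor \<open>y powr (b - 1)\<close> records that \<open>\<lambda>x. x powr b\<close> flattens away from the origin. By
  homogeneity the claim reduces to \<open>u powr b \<le> u\<close> for \<open>u = x / y \<ge> 1\<close>.
\<close>
lemma powr_diff_le:
  fixes x y b :: real
  assumes "0 < y" and "y \<le> x" and "b \<le> 1"
  shows "x powr b - y powr b \<le> y powr (b - 1) * (x - y)"
proof -
  have "(x / y) powr b \<le> (x / y) powr 1" using assms by (intro powr_mono) auto
  then have "x powr b \<le> y powr b * (x / y)"
    using assms by (simp add: powr_divide field_simps)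
  also have "\<dots> = y powr (b - 1) * x" using assms by (simp add: powr_diff)
  finally show ?thesis using assms by (simp add: powr_diff field_simps)
qed

text \<open>
  The integral test: by the mean value theorem \<open>b * j powr (b - 1)\<close> is at most the increment
  \<open>j powr b - (j - 1) powr b\<close>, and the increments telescope. The term \<open>j = 0\<close> is zero.
\<close>
lemma sum_powr_le:
  fixes b :: real
  assumes b: "0 < b" "b \<le> 1"
  shows "(\<Sum>j\<le>M. real j powr (b - 1)) \<le> real M powr b / b"
proof (induction M)
  case (Suc M)
  have "b * real (Suc M) powr (b - 1) \<le> real (Suc M) powr b - real M powr b"
  proof (cases "M = 0")
    case False
    have "\<exists>z>real M. z < real (Suc M) \<and>
        real (Suc M) powr b - real M powr b = (real (Suc M) - real M) * (b * z powr (b - 1))"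
      by (rule MVT2) (use False in \<open>auto intro!: has_real_derivative_powr\<close>)
    then obtain z where z: "z > real M" "z < real (Suc M)"
      "real (Suc M) powr b - real M powr b = b * z powr (b - 1)" by auto
    have "real (Suc M) powr (b - 1) \<le> z powr (b - 1)"
      using z b False by (intro powr_mono2') auto
    then show ?thesis using z(3) b by simp
  qed (use b in auto)
  then have "real (Suc M) powr (b - 1) \<le> real (Suc M) powr b / b - real M powr b / b"
    using b by (simp add: field_simps)
  then show ?case using Suc.IH by simp
qed simp

section \<open>Heights over a fixed horizontal vector\<close>

lemma hom_norm_near_imp_power_bounds:
  assumes "\<alpha> \<ge> 1" and "\<delta> < R" and "\<bar>hom_norm \<alpha> (z, t) - R\<bar> \<le> \<delta>"
  shows "(R - \<delta>) ^ \<alpha> \<le> norm z ^ \<alpha> + \<bar>t\<bar> powr (real \<alpha> / 2)"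
    and "norm z ^ \<alpha> + \<bar>t\<bar> powr (real \<alpha> / 2) \<le> (R + \<delta>) ^ \<alpha>"
proof -
  let ?h = "hom_norm \<alpha> (z, t)"
  have "?h ^ \<alpha> = ?h powr real \<alpha>"
    using assms(1) by (subst powr_realpow') (auto simp: hom_norm_def)
  also have "\<dots> = norm z ^ \<alpha> + \<bar>t\<bar> powr (real \<alpha> / 2)"
    using assms(1) by (simp add: hom_norm_def powr_powr)
  finally have h: "norm z ^ \<alpha> + \<bar>t\<bar> powr (real \<alpha> / 2) = ?h ^ \<alpha>" by simp
  show "(R - \<delta>) ^ \<alpha> \<le> norm z ^ \<alpha> + \<bar>t\<bar> powr (real \<alpha> / 2)"
    "norm z ^ \<alpha> + \<bar>t\<bar> powr (real \<alpha> / 2) \<le> (R + \<delta>) ^ \<alpha>"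
    unfolding h using assms by (auto intro!: power_mono simp: abs_le_iff)
qed

text \<open>
  The number \<open>j\<close> is the depth \<open>R + 1 - norm z\<close>, rounded with an error
  of at most one. If \<open>j \<ge> 4\<close>, then \<open>R - \<delta> - norm z \<ge> j / 4\<close>, so \<open>\<bar>s\<bar> powr (\<alpha> / 2)\<close> is of order
  at least \<open>j * R ^ (\<alpha> - 1)\<close> and \<open>powr_diff_le\<close> applies. If \<open>j \<le> 3\<close>, then \<open>\<bar>s\<bar>\<close> may be zero, and
  the difference is bounded by \<open>\<bar>t\<bar>\<close> alone. In both cases the power of \<open>R\<close> is
  \<open>(\<alpha> - 1) * b = 2 - b\<close>.
\<close>
lemma height_gap:
  assumes \<alpha>: "\<alpha> \<ge> 2" and b: "b = 2 / real \<alpha>"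
  shows "\<exists>K\<ge>0. \<forall>R \<delta> (z :: real ^ 'm) s t j. R > 1 \<longrightarrow> 0 \<le> \<delta> \<longrightarrow> \<delta> < 1 \<longrightarrow>
    \<bar>hom_norm \<alpha> (z, t) - R\<bar> \<le> \<delta> \<longrightarrow> \<bar>hom_norm \<alpha> (z, s) - R\<bar> \<le> \<delta> \<longrightarrow>
    real j - 1 \<le> R + 1 - norm z \<longrightarrow> R + 1 - norm z \<le> real j + 1 \<longrightarrow>
    \<bar>t\<bar> - \<bar>s\<bar> \<le> K * R powr (2 - b) * (of_bool (j \<le> 3) + \<delta> * real j powr (b - 1))"
proof -
  define E where "E = 4 * real \<alpha> * 2 ^ (\<alpha> - 1)"
  define c where "c = (1 / 4) * (1 / 2 :: real) ^ (\<alpha> - 1)"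
  define K where "K = E powr b + c powr (b - 1) * E"
  have b01: "0 < b" "b \<le> 1" using \<alpha> unfolding b by auto
  have E: "E > 0" and c: "c > 0" and K: "K \<ge> 0" using \<alpha> by (auto simp: E_def c_def K_def)
  have "\<bar>t\<bar> - \<bar>s\<bar> \<le> K * R powr (2 - b) * (of_bool (j \<le> 3) + \<delta> * real j powr (b - 1))"
    if R: "R > 1" and \<delta>: "0 \<le> \<delta>" "\<delta> < 1"
      and t: "\<bar>hom_norm \<alpha> (z, t) - R\<bar> \<le> \<delta>" and s: "\<bar>hom_norm \<alpha> (z, s) - R\<bar> \<le> \<delta>"
      and j: "real j - 1 \<le> R + 1 - norm z" "R + 1 - norm z \<le> real j + 1"
    for R \<delta> s t j and z :: "real ^ 'm"
  proof -
    define r where "r = norm z"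
    define P where "P = R ^ (\<alpha> - 1)"
    define U where "U = \<bar>t\<bar> powr (real \<alpha> / 2)"
    define V where "V = \<bar>s\<bar> powr (real \<alpha> / 2)"
    have "\<delta> < R" "1 \<le> \<alpha>" using R \<delta> \<alpha> by auto
    note tt = hom_norm_near_imp_power_bounds[OF this(2,1) t, folded r_def U_def]
    note ss = hom_norm_near_imp_power_bounds[OF \<open>1 \<le> \<alpha>\<close> \<open>\<delta> < R\<close> s, folded r_def V_def]
    have r0: "r \<ge> 0" and P0: "P > 0" using R by (auto simp: r_def P_def)
    have UV: "\<bar>t\<bar> = U powr b" "\<bar>s\<bar> = V powr b" "U \<ge> 0" "V \<ge> 0"
      using \<alpha> by (auto simp: U_def V_def b powr_powr)
    have Pb: "P powr b = R powr (2 - b)"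
    proof -
      have "P = R powr (real \<alpha> - 1)"
        using R \<alpha> unfolding P_def by (subst powr_realpow[symmetric]) (auto simp: of_nat_diff)
      then show ?thesis using \<alpha> by (simp add: powr_powr b field_simps)
    qed
    have twoR: "(R + \<delta>) ^ (\<alpha> - 1) \<le> 2 ^ (\<alpha> - 1) * P"
      unfolding P_def power_mult_distrib[symmetric] using R \<delta> by (intro power_mono) auto
    have main: "\<bar>t\<bar> - \<bar>s\<bar> \<le> P powr b *
        (E powr b * of_bool (j \<le> 3) + c powr (b - 1) * E * \<delta> * real j powr (b - 1))"
    proof (cases "j \<le> 3")
      case True
      have "r ^ \<alpha> \<le> (R + \<delta>) ^ \<alpha>" using tt UV by linarith
      then have rR: "r \<le> R + \<delta>"
        using \<alpha> R \<delta> by (intro power_le_imp_le_base[of r "\<alpha> - 1"]) (auto simp: Suc_diff_Suc)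
      have "U \<le> (R + \<delta>) ^ \<alpha> - r ^ \<alpha>" using tt by linarith
      also have "\<dots> \<le> real \<alpha> * (R + \<delta>) ^ (\<alpha> - 1) * (R + \<delta> - r)"
        using power_diff_bounds(2)[OF r0 rR] \<alpha> by auto
      also have "\<dots> \<le> real \<alpha> * (2 ^ (\<alpha> - 1) * P) * 4"
        using twoR rR R \<delta> j True P0 by (intro mult_mono) (auto simp: r_def)
      finally have "U \<le> E * P" by (simp add: E_def)
      then have "\<bar>t\<bar> \<le> (E * P) powr b" unfolding UV using UV b01 by (intro powr_mono2) auto
      then have "\<bar>t\<bar> - \<bar>s\<bar> \<le> P powr b * E powr b" by (simp add: powr_mult mult.commute)
      also have "\<dots> \<le> P powr b *
        (E powr b * of_bool (j \<le> 3) + c powr (b - 1) * E * \<delta> * real j powr (b - 1))"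
        using True E \<delta> by (intro mult_left_mono) auto
      finally show ?thesis .
    next
      case False
      have jR: "real j / 4 \<le> R - \<delta> - r" "R / 2 \<le> R - \<delta>"
        using j False r0 \<delta> R unfolding r_def by linarith+
      (* The norm of z is nonnegative, so j >= 4 forces R - \<delta> >= 1, and hence R - \<delta> >= R / 2. *)
      have V: "c * real j * P \<le> V"
      proof -
        have "c * real j * P = (R / 2) ^ (\<alpha> - 1) * (real j / 4)"
          by (simp add: c_def P_def power_divide mult_ac)
        also have "\<dots> \<le> (R - \<delta>) ^ (\<alpha> - 1) * (R - \<delta> - r)"
          using jR R by (intro mult_mono power_mono) auto
        also have "\<dots> \<le> (R - \<delta>) ^ \<alpha> - r ^ \<alpha>"
          using jR by (intro power_diff_bounds(1) r0) (use \<alpha> in auto)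
        finally show ?thesis using ss by linarith
      qed
      have pos: "c * real j * P > 0" using c P0 False by auto
      show ?thesis
      proof (cases "V \<le> U")
        case True
        have "U - V \<le> (R + \<delta>) ^ \<alpha> - (R - \<delta>) ^ \<alpha>" using tt ss by linarith
        also have "\<dots> \<le> real \<alpha> * (R + \<delta>) ^ (\<alpha> - 1) * (R + \<delta> - (R - \<delta>))"
          by (intro power_diff_bounds(2)) (use R \<delta> \<alpha> in auto)
        also have "\<dots> \<le> real \<alpha> * (2 ^ (\<alpha> - 1) * P) * (4 * \<delta>)"
          using twoR P0 R \<delta> by (intro mult_mono) auto
        finally have UmV: "U - V \<le> E * P * \<delta>" by (simp add: E_def)
        have "\<bar>t\<bar> - \<bar>s\<bar> \<le> V powr (b - 1) * (U - V)"
          unfolding UV using V pos True b01 by (intro powr_diff_le) auto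
        also have "\<dots> \<le> (c * real j * P) powr (b - 1) * (E * P * \<delta>)"
          using V pos True b01 UmV by (intro mult_mono powr_mono2') auto
        also have "\<dots> = P powr b * (c powr (b - 1) * E * \<delta> * real j powr (b - 1))"
          using P0 c by (simp add: powr_mult powr_diff abs_mult field_simps)
        finally show ?thesis using False by simp
      next
        case notle: False
        then have "\<bar>t\<bar> \<le> \<bar>s\<bar>" unfolding UV using UV b01 by (intro powr_mono2) auto
        moreover have "0 \<le> P powr b *
          (E powr b * of_bool (j \<le> 3) + c powr (b - 1) * E * \<delta> * real j powr (b - 1))"
          using E \<delta> by (intro mult_nonneg_nonneg add_nonneg_nonneg) auto
        ultimately show ?thesis by linarith
      qed
    qed
    have "E powr b * of_bool (j \<le> 3) + c powr (b - 1) * E * \<delta> * real j powr (b - 1)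
       \<le> K * of_bool (j \<le> 3) + K * (\<delta> * real j powr (b - 1))"
      unfolding mult.assoc[of _ \<delta>] 
      using E c \<delta> by (intro add_mono mult_right_mono) (auto simp: K_def)
    then have "P powr b *
        (E powr b * of_bool (j \<le> 3) + c powr (b - 1) * E * \<delta> * real j powr (b - 1))
       \<le> P powr b * (K * of_bool (j \<le> 3) + K * (\<delta> * real j powr (b - 1)))"
      by (intro mult_left_mono) auto
    with main show ?thesis unfolding Pb by (simp add: algebra_simps)
  qed
  then show ?thesis using K by blast
qed

section \<open>Counting lattice points near a sphere\<close>

text \<open>
  The annulus is cut into the shells \<open>M - j \<le> norm z \<le> M - j + 1\<close> for \<open>j \<le> M\<close>, where
  \<open>M = \<lfloor>R\<rfloor> + 1\<close>. Indexing them by the depth \<open>j\<close>, and not by the norm, makes the sum over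
  the shells the one in \<open>sum_powr_le\<close>.
\<close>
lemma card_lattice_near_sphere:
  fixes \<alpha> :: nat
  assumes \<alpha>: "\<alpha> \<ge> 2"
  defines "A \<equiv> \<lambda>R \<delta>. {m \<in> (int_lattice :: ((real ^ 'm) \<times> real) set). \<bar>hom_norm \<alpha> m - R\<bar> \<le> \<delta>}"
  shows "\<exists>C>0. \<forall>R \<delta>. R > 1 \<longrightarrow> 0 \<le> \<delta> \<longrightarrow> \<delta> < 1 \<longrightarrow> finite (A R \<delta>) \<and>
    real (card (A R \<delta>)) \<le> C * (R ^ CARD('m) + R powr (real CARD('m) + 1 - 2 / real \<alpha>)
      + R ^ (CARD('m) + 1) * \<delta>)"
proof -
  define b where "b = 2 / real \<alpha>"
  have b01: "0 < b" "b \<le> 1" using \<alpha> unfolding b_def by auto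
  obtain K where K: "K \<ge> 0" and gap: "\<And>R \<delta> (z :: real ^ 'm) s t j. R > 1 \<Longrightarrow> 0 \<le> \<delta> \<Longrightarrow> \<delta> < 1 \<Longrightarrow>
    \<bar>hom_norm \<alpha> (z, t) - R\<bar> \<le> \<delta> \<Longrightarrow> \<bar>hom_norm \<alpha> (z, s) - R\<bar> \<le> \<delta> \<Longrightarrow>
    real j - 1 \<le> R + 1 - norm z \<Longrightarrow> R + 1 - norm z \<le> real j + 1 \<Longrightarrow>
    \<bar>t\<bar> - \<bar>s\<bar> \<le> K * R powr (2 - b) * (of_bool (j \<le> 3) + \<delta> * real j powr (b - 1))"
    using height_gap[where 'm = 'm, OF \<alpha> b_def] by metis
  let ?N = "CARD('m)"
  define L where "L = real ?N * (8 * real ?N + 2) * 9 ^ (?N - 1)"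
  define C where "C = L * (6 + 16 * K + 8 * K / b)"
  have L: "L > 0" unfolding L_def by auto
  have C: "C > 0" unfolding C_def using L K b01 by (intro mult_pos_pos add_pos_nonneg) auto
  have "finite (A R \<delta>) \<and> real (card (A R \<delta>)) \<le>
      C * (R ^ ?N + R powr (real ?N + 1 - b) + R ^ (?N + 1) * \<delta>)"
    if R: "R > 1" and \<delta>: "0 \<le> \<delta>" "\<delta> < 1" for R \<delta>
  proof -
    define M where "M = nat \<lfloor>R\<rfloor> + 1"
    have M: "R \<le> real M" "real M \<le> R + 1" using R unfolding M_def by linarith+
    define Sh where "Sh k = {z :: real ^ 'm. (\<forall>i. z $ i \<in> \<int>) \<and> real k \<le> norm z \<and> norm z \<le> real k + 1}" for k
    define T where "T z = {t \<in> \<int>. \<bar>hom_norm \<alpha> (z, t) - R\<bar> \<le> \<delta>}" for z :: "real ^ 'm"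
    define Q where "Q = R powr (2 - b)"
    define D where "D j = K * Q * (of_bool (j \<le> 3) + \<delta> * real j powr (b - 1))" for j :: nat
    have D0: "D j \<ge> 0" for j using K \<delta> unfolding D_def Q_def by auto
    have Sh: "finite (Sh (M - j)) \<and> real (card (Sh (M - j))) \<le> L * R ^ (?N - 1)" for j
    proof -
      have "finite (Sh (M - j)) \<and> real (card (Sh (M - j))) \<le>
        real ?N * (8 * real ?N + 2) * (3 * (real (M - j) + 1)) ^ (?N - 1)"
        unfolding Sh_def by (rule card_int_vectors_in_shell) simp
      moreover have "(3 * (real (M - j) + 1)) ^ (?N - 1) \<le> (9 * R) ^ (?N - 1)"
        using M R by (intro power_mono) auto
      ultimately show ?thesis
        unfolding L_def mult.assoc power_mult_distrib[symmetric]
        by (auto intro: order_trans mult_left_mono)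
    qed
    have T: "finite (T z) \<and> real (card (T z)) \<le> 4 * D j + 2" if "j \<le> M" "z \<in> Sh (M - j)" for j z
    proof (rule card_Ints_close_abs)
      have "real j - 1 \<le> R + 1 - norm z" "R + 1 - norm z \<le> real j + 1"
        using that M unfolding Sh_def by (auto simp: of_nat_diff)
      then show "\<bar>x\<bar> - \<bar>y\<bar> \<le> D j" if "x \<in> T z" "y \<in> T z" for x y
        using gap[OF R \<delta>] that unfolding T_def D_def Q_def by blast
    qed (use D0 in \<open>auto simp: T_def\<close>)
    have cover: "A R \<delta> \<subseteq> (\<Union>j\<in>{..M}. Sigma (Sh (M - j)) T)"
    proof
      fix m assume m: "m \<in> A R \<delta>"
      obtain z t where zt: "m = (z, t)" by (cases m)
      have z: "\<forall>i. z $ i \<in> \<int>" "t \<in> T z" using m unfolding A_def zt int_lattice_def T_def by auto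
      have "norm z ^ \<alpha> \<le> norm z ^ \<alpha> + \<bar>t\<bar> powr (real \<alpha> / 2)" by simp
      also have "\<dots> \<le> (R + \<delta>) ^ \<alpha>"
        by (rule hom_norm_near_imp_power_bounds(2)) (use z(2) R \<delta> \<alpha> in \<open>auto simp: T_def\<close>)
      finally have "norm z \<le> R + \<delta>"
        using \<alpha> R \<delta> by (intro power_le_imp_le_base[of "norm z" "\<alpha> - 1"]) (auto simp: Suc_diff_Suc)
      then have "nat \<lfloor>norm z\<rfloor> \<le> M" using \<delta> R unfolding M_def by linarith
      moreover have "z \<in> Sh (nat \<lfloor>norm z\<rfloor>)" unfolding Sh_def using z by (auto; linarith)
      ultimately have "M - nat \<lfloor>norm z\<rfloor> \<le> M" "z \<in> Sh (M - (M - nat \<lfloor>norm z\<rfloor>))" by auto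
      then show "m \<in> (\<Union>j\<in>{..M}. Sigma (Sh (M - j)) T)" using z unfolding zt by blast
    qed
    have finU: "finite (\<Union>j\<in>{..M}. Sigma (Sh (M - j)) T)" using Sh T by auto
    have heights: "(\<Sum>j\<le>M. 4 * D j + 2) \<le> 6 * R + 16 * K * Q + 8 * K / b * R\<^sup>2 * \<delta>"
    proof -
      have "(\<Sum>j\<le>M. of_bool (j \<le> 3) :: real) = real (card ({..M} \<inter> {..3}))"
        by (simp add: of_bool_def sum.If_cases atMost_def)
      also have "\<dots> \<le> real (card {..3::nat})" by (intro of_nat_mono card_mono) auto
      finally have 1: "(\<Sum>j\<le>M. of_bool (j \<le> 3) :: real) \<le> 4" by simp
      have "(\<Sum>j\<le>M. real j powr (b - 1)) \<le> real M powr b / b" by (rule sum_powr_le[OF b01])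
      also have "\<dots> \<le> (2 * R) powr b / b"
        using M R b01 by (intro divide_right_mono powr_mono2) auto
      also have "\<dots> \<le> 2 powr 1 * R powr b / b"
        unfolding powr_mult using b01 by (intro divide_right_mono mult_right_mono powr_mono) auto
      finally have 2: "(\<Sum>j\<le>M. real j powr (b - 1)) \<le> 2 * R powr b / b" by simp
      have QR: "Q * R powr b = R\<^sup>2" unfolding Q_def powr_add[symmetric] using R by simp
      have "(\<Sum>j\<le>M. 4 * (c * (f j + \<delta> * g j)) + 2) =
          2 * (real M + 1) + 4 * c * ((\<Sum>j\<le>M. f j) + \<delta> * (\<Sum>j\<le>M. g j))"
        for c :: real and f g :: "nat \<Rightarrow> real"
        by (simp add: sum.distrib algebra_simps flip: sum_distrib_left sum_distrib_right)
      from this[of "K * Q" "\<lambda>j. of_bool (j \<le> 3)" "\<lambda>j. real j powr (b - 1)"]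
      have "(\<Sum>j\<le>M. 4 * D j + 2) = 2 * (real M + 1) + 4 * K * Q *
          ((\<Sum>j\<le>M. of_bool (j \<le> 3)) + \<delta> * (\<Sum>j\<le>M. real j powr (b - 1)))"
        unfolding D_def mult.assoc .
      also have "\<dots> \<le> 2 * (3 * R) + 4 * K * Q * (4 + \<delta> * (2 * R powr b / b))"
        using 1 2 M R K \<delta> by (intro add_mono mult_left_mono) (auto simp: Q_def)
      also have "\<dots> = 6 * R + 16 * K * Q + 8 * K / b * (Q * R powr b) * \<delta>"
        by (simp add: algebra_simps)
      finally show ?thesis unfolding QR .
    qed
    have "card (A R \<delta>) \<le> card (\<Union>j\<in>{..M}. Sigma (Sh (M - j)) T)"
      by (rule card_mono[OF finU cover])
    also have "\<dots> \<le> (\<Sum>j\<le>M. card (Sigma (Sh (M - j)) T))" by (rule card_UN_le) simp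
    also have "\<dots> = (\<Sum>j\<le>M. \<Sum>z\<in>Sh (M - j). card (T z))"
      using Sh T by (intro sum.cong card_SigmaI) auto
    finally have "real (card (A R \<delta>)) \<le> real (\<Sum>j\<le>M. \<Sum>z\<in>Sh (M - j). card (T z))"
      by (rule of_nat_mono)
    also have "\<dots> = (\<Sum>j\<le>M. \<Sum>z\<in>Sh (M - j). real (card (T z)))" by simp
    also have "\<dots> \<le> (\<Sum>j\<le>M. \<Sum>z\<in>Sh (M - j). 4 * D j + 2)"
      using T by (intro sum_mono) auto
    also have "\<dots> = (\<Sum>j\<le>M. real (card (Sh (M - j))) * (4 * D j + 2))" by simp
    also have "\<dots> \<le> (\<Sum>j\<le>M. L * R ^ (?N - 1) * (4 * D j + 2))"
      using Sh D0 by (intro sum_mono mult_right_mono) auto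
    also have "\<dots> = L * R ^ (?N - 1) * (\<Sum>j\<le>M. 4 * D j + 2)" by (simp add: sum_distrib_left)
    also have "\<dots> \<le> L * R ^ (?N - 1) * (6 * R + 16 * K * Q + 8 * K / b * R\<^sup>2 * \<delta>)"
      using heights L R by (intro mult_left_mono) auto
    also have "\<dots> \<le> L * R ^ (?N - 1) * ((6 + 16 * K + 8 * K / b) * (R + Q + R\<^sup>2 * \<delta>))"
    proof (intro mult_left_mono)
      have "0 \<le> Q" "0 \<le> R\<^sup>2 * \<delta>" "0 \<le> 8 * K / b" using K R \<delta> b01 by (auto simp: Q_def)
      then show "6 * R + 16 * K * Q + 8 * K / b * R\<^sup>2 * \<delta>
          \<le> (6 + 16 * K + 8 * K / b) * (R + Q + R\<^sup>2 * \<delta>)"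
        using K R unfolding distrib_left distrib_right mult.assoc[of "8 * K / b"]
        by (smt (verit) mult_nonneg_nonneg)
    qed (use L R in auto)
    also have "\<dots> = C * (R ^ (?N - 1) * R + R ^ (?N - 1) * Q + R ^ (?N - 1) * R\<^sup>2 * \<delta>)"
    proof -
      have "L * p * (h * (R + Q + R\<^sup>2 * \<delta>)) = L * h * (p * R + p * Q + p * R\<^sup>2 * \<delta>)"
        for p h by (simp add: algebra_simps)
      then show ?thesis unfolding C_def .
    qed
    also have "R ^ (?N - 1) * R = R ^ ?N" by (metis power_minus_mult zero_less_card_finite)
    also have "R ^ (?N - 1) * R\<^sup>2 = R ^ (?N + 1)"
    proof -
      have "?N - 1 + 2 = ?N + 1" using zero_less_card_finite[where 'a = 'm] by linarith
      then show ?thesis by (metis power_add)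
    qed
    also have "R ^ (?N - 1) * Q = R powr (real ?N + 1 - b)"
    proof -
      have "R ^ (?N - 1) = R powr (real ?N - 1)"
        using R by (subst powr_realpow[symmetric]) (auto simp: of_nat_diff Suc_leI)
      then show ?thesis unfolding Q_def by (simp add: algebra_simps flip: powr_add)
    qed
    finally show ?thesis using finite_subset[OF cover finU] by blast
  qed
  then show ?thesis using C unfolding b_def by blast
qed

text \<open>
  Both bounds are linear conditions on \<open>g = gamma_exp n \<alpha>\<close> once the denominator \<open>2 d - g\<close> is
  cleared. For \<open>\<alpha> = 2\<close> they are equivalent, and \<open>g = d - 1 / 2\<close>; otherwise they follow from
  \<open>\<alpha> * g \<le> 2 * d\<close> and \<open>2 * g \<le> 1\<close>.
\<close>
lemma gamma_exp_quotient_le: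
  assumes "d \<ge> 1" and "\<alpha> \<ge> 2" and "n = 2 * d + 1"
  shows "gamma_exp n \<alpha> / (real n - 1 - gamma_exp n \<alpha>) \<le> 2 / real \<alpha>"
    and "gamma_exp n \<alpha> / (real n - 1 - gamma_exp n \<alpha>) \<le> 1"
proof -
  define g where "g = gamma_exp n \<alpha>"
  have d: "real d \<ge> 1" and n: "real n = 2 * real d + 1" using assms by auto
  have *: "g \<le> real d - 1 / 2 \<and> real \<alpha> * g \<le> 4 * real d - 2 * g"
  proof (cases "\<alpha> = 2")
    case True
    then show ?thesis using n by (simp add: g_def gamma_exp_def field_simps)
  next
    case False
    then have "g \<le> 2 * real d / real \<alpha>" "g \<le> 1 / 2" by (auto simp: g_def gamma_exp_def n)
    then have "real \<alpha> * g \<le> 2 * real d" "g \<le> 1 / 2" using assms(2) by (auto simp: field_simps)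
    then show ?thesis using d by linarith
  qed
  then have "real n - 1 - g > 0" using n d by linarith
  then show "gamma_exp n \<alpha> / (real n - 1 - gamma_exp n \<alpha>) \<le> 2 / real \<alpha>"
    "gamma_exp n \<alpha> / (real n - 1 - gamma_exp n \<alpha>) \<le> 1"
    unfolding g_def[symmetric] using * assms(2) n by (auto simp: field_simps)
qed

theorem corollary1p2:
  fixes d n \<alpha> :: nat
  assumes "d \<ge> 1" and "\<alpha> \<ge> 2" and "n = 2 * d + 1"
    and "CARD('m::finite) = 2 * d"
  shows "\<exists>C::real. C > 0 \<and> (\<forall>R \<delta>::real. R > 1 \<longrightarrow> 0 \<le> \<delta> \<longrightarrow> \<delta> < 1 \<longrightarrow>
    (let S = {(m, p). m \<in> (int_lattice :: ((real ^ 'm) \<times> real) set) \<and> p \<in> int_lattice \<and>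
                \<bar>hom_norm \<alpha> m - R\<bar> \<le> \<delta> \<and> \<bar>hom_norm \<alpha> (m - p) - R\<bar> \<le> \<delta>}
     in finite S \<and>
        real (card S) \<le> C * max
          (R powr (2 * (real n - gamma_exp n \<alpha> / (real n - 1 - gamma_exp n \<alpha>))))
          ((R ^ n * \<delta>)\<^sup>2)))"
proof -
  define A where "A R \<delta> = {m \<in> (int_lattice :: ((real ^ 'm) \<times> real) set). \<bar>hom_norm \<alpha> m - R\<bar> \<le> \<delta>}" for R \<delta>
  define e where "e = gamma_exp n \<alpha> / (real n - 1 - gamma_exp n \<alpha>)"
  have e: "e \<le> 2 / real \<alpha>" "e \<le> 1"
    using gamma_exp_quotient_le[OF assms(1-3)] by (auto simp: e_def)
  have n: "CARD('m) + 1 = n" "real CARD('m) = real n - 1" using assms by auto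
  have "\<exists>C>0. \<forall>R \<delta>. R > 1 \<longrightarrow> 0 \<le> \<delta> \<longrightarrow> \<delta> < 1 \<longrightarrow> finite (A R \<delta>) \<and>
    real (card (A R \<delta>)) \<le> C * (R ^ CARD('m) + R powr (real CARD('m) + 1 - 2 / real \<alpha>)
      + R ^ (CARD('m) + 1) * \<delta>)"
    unfolding A_def by (rule card_lattice_near_sphere[OF assms(2)])
  then obtain C where C: "C > 0" and count: "\<And>R \<delta>. R > 1 \<Longrightarrow> 0 \<le> \<delta> \<Longrightarrow> \<delta> < 1 \<Longrightarrow> finite (A R \<delta>) \<and>
    real (card (A R \<delta>)) \<le> C * (R ^ CARD('m) + R powr (real CARD('m) + 1 - 2 / real \<alpha>)
      + R ^ (CARD('m) + 1) * \<delta>)"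
    by blast
  have "finite S \<and> real (card S) \<le> 9 * C\<^sup>2 * max (R powr (2 * (real n - e))) ((R ^ n * \<delta>)\<^sup>2)"
    if R: "R > 1" and \<delta>: "0 \<le> \<delta>" "\<delta> < 1"
      and S: "S = {(m, p). m \<in> (int_lattice :: ((real ^ 'm) \<times> real) set) \<and> p \<in> int_lattice \<and>
                \<bar>hom_norm \<alpha> m - R\<bar> \<le> \<delta> \<and> \<bar>hom_norm \<alpha> (m - p) - R\<bar> \<le> \<delta>}" for R \<delta> S
  proof -
    define X where "X = max (R powr (real n - e)) (R ^ n * \<delta>)"
    have diff: "m - p \<in> int_lattice" if "m \<in> int_lattice" "p \<in> int_lattice"
      for m p :: "(real ^ 'm) \<times> real"
      using that by (auto simp: int_lattice_def)
    have bij: "bij_betw (\<lambda>(m, p). (m, m - p)) S (A R \<delta> \<times> A R \<delta>)"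
    proof (rule bij_betwI[where g = "\<lambda>(m, q). (m, m - q)"])
      show "(\<lambda>(m, p). (m, m - p)) \<in> S \<rightarrow> A R \<delta> \<times> A R \<delta>"
        "(\<lambda>(m, q). (m, m - q)) \<in> A R \<delta> \<times> A R \<delta> \<rightarrow> S"
        unfolding S A_def using diff by auto
    qed auto
    have fin: "finite (A R \<delta>)" using count[OF R \<delta>] by blast
    have "R ^ CARD('m) = R powr (real n - 1)"
      using R by (subst powr_realpow[symmetric]) (auto simp: n)
    also have "\<dots> \<le> R powr (real n - e)" using R e by (intro powr_mono) auto
    finally have 1: "R ^ CARD('m) \<le> X" unfolding X_def by simp
    have "R powr (real CARD('m) + 1 - 2 / real \<alpha>) \<le> R powr (real n - e)"
      unfolding n using R e by (intro powr_mono) auto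
    then have 2: "R powr (real CARD('m) + 1 - 2 / real \<alpha>) \<le> X" unfolding X_def by simp
    have 3: "R ^ (CARD('m) + 1) * \<delta> \<le> X" unfolding X_def n by simp
    have "real (card (A R \<delta>)) \<le> C * (R ^ CARD('m) + R powr (real CARD('m) + 1 - 2 / real \<alpha>)
      + R ^ (CARD('m) + 1) * \<delta>)" using count[OF R \<delta>] by blast
    also have "\<dots> \<le> C * (X + X + X)" using 1 2 3 C by (intro mult_left_mono add_mono) auto
    finally have A: "real (card (A R \<delta>)) \<le> 3 * C * X" by simp
    have "real (card S) = (real (card (A R \<delta>)))\<^sup>2"
      using bij_betw_same_card[OF bij] by (simp add: card_cartesian_product power2_eq_square)
    also have "\<dots> \<le> (3 * C * X)\<^sup>2" using A by (intro power_mono) auto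
    also have "\<dots> = 9 * C\<^sup>2 * X\<^sup>2" by (simp add: power_mult_distrib)
    also have "\<dots> \<le> 9 * C\<^sup>2 * max (R powr (2 * (real n - e))) ((R ^ n * \<delta>)\<^sup>2)"
    proof -
      have "(R powr (real n - e))\<^sup>2 = R powr (2 * (real n - e))"
        by (simp add: power2_eq_square flip: powr_add)
      then have "X\<^sup>2 \<le> max (R powr (2 * (real n - e))) ((R ^ n * \<delta>)\<^sup>2)"
        unfolding X_def by (auto simp: max_def)
      then show ?thesis by (intro mult_left_mono) auto
    qed
    finally show ?thesis using bij_betw_finite[OF bij] fin by simp
  qed
  then show ?thesis using C unfolding e_def Let_def
    by (intro exI[of _ "9 * C\<^sup>2"]) (simp add: zero_less_power)
qed

end
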